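(* Let $I=(N,O,L)$ be an instance of House Allocation (with ties allowed). Every Pareto optimal matching $\mu$ in $I$ can be generated by some execution of SDMT-1 (defined in the context); that is, there exist an order $\sigma$ of the agents and a choice of augmenting paths in the run of SDMT-1 with order $\sigma$ such that the matching returned is $\mu$.
   Context: House Allocation (HA). $N$ is a finite set of agents, $O$ a finite set of objects with $|O|=n_2$. Each agent $i$ has a preference list $L(i)=(C^i_1\succ_i C^i_2\succ_i\cdots)$, an ordered sequence of pairwise disjoint subsets of $O$ (indifference classes, all nonempty classes coming first); objects in $C^i_k$ are strictly preferred to those in $C^i_l$ for $k<l$, and $i$ is indifferent between objects in the same class. Objects in $\bigcup_k C^i_k$ are acceptable to $i$. $rank(i,o)=k$ if $o\in C^i_k$, and $n_2+1$ if $o$ is unacceptable or if $i$ is unmatched; $i$ prefers smaller rank. A matching is a set of (agent, acceptable object) pairs in which every agent and every object occurs at most once. $\mu$ is Pareto optimal if there is no matching $\mu'$ with $\mu'(i)\succeq_i\mu(i)$ for all $i$ and $\mu'(i')\succ_{i'}\mu(i')$ for some $i'$. SDMT-1, given an order $\sigma$ of the agents: start with the bipartite graph $G=(N\cup O,E)$, $E=\emptyset$, and $\mu=\emptyset$. Process agents in the order $\sigma$. For the current agent $i$, for $\ell=1,2,\dots$ while $C^i_\ell\neq\emptyset$: add the edges $\{(i,o):o\in C^i_\ell\}$ to $E$; if $G$ contains an augmenting path with respect to $\mu$ starting at $i$ (a path from $i$ to an unmatched object, alternating between edges not in $\mu$ and edges in $\mu$), choose any such path, replace $\mu$ by its symmetric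 difference with the path, and go to the next agent; otherwise remove the edges just added and increase $\ell$ by one. Return $\mu$ after all agents are processed. *)

theory Defs
  imports Main
begin

text \<open>An instance of House Allocation with ties is given by a set of agents \<open>N\<close>, a set of objects
  \<open>Obj\<close>, and preference lists \<open>C\<close>, where \<open>C i k\<close> is the \<open>k\<close>-th indifference class of agent \<open>i\<close>.
  Classes are numbered from 1, so the value \<open>C i 0\<close> is never used. Only finitely many of the
  classes \<open>C i 1, C i 2, \<dots>\<close> are nonempty, because they are disjoint subsets of a finite set.\<close>

definition house_allocation :: "'a set \<Rightarrow> 'b set \<Rightarrow> ('a \<Rightarrow> nat \<Rightarrow> 'b set) \<Rightarrow> bool" where
  "house_allocation N Obj C \<longleftrightarrow>
     finite N \<and> finite Obj \<and>
     (\<forall>i\<in>N. \<forall>k\<ge>1. C i k \<subseteq> Obj) \<and>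
     (\<forall>i\<in>N. \<forall>k\<ge>1. \<forall>l\<ge>1. k \<noteq> l \<longrightarrow> C i k \<inter> C i l = {}) \<and>
     (\<forall>i\<in>N. \<forall>k\<ge>1. \<forall>l\<ge>k. C i k = {} \<longrightarrow> C i l = {})"

definition acceptable :: "('a \<Rightarrow> nat \<Rightarrow> 'b set) \<Rightarrow> 'a \<Rightarrow> 'b set" where
  "acceptable C i = (\<Union>k\<in>{1..}. C i k)"

text \<open>The value \<open>None\<close> stands for being unmatched.\<close>

definition rank :: "'b set \<Rightarrow> ('a \<Rightarrow> nat \<Rightarrow> 'b set) \<Rightarrow> 'a \<Rightarrow> 'b option \<Rightarrow> nat" where
  "rank Obj C i a =
     (case a of
        None \<Rightarrow> card Obj + 1
      | Some x \<Rightarrow> if x \<in> acceptable C i then (THE k. k \<ge> 1 \<and> x \<in> C i k) else card Obj + 1)"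

definition matching :: "'a set \<Rightarrow> ('a \<Rightarrow> nat \<Rightarrow> 'b set) \<Rightarrow> ('a \<times> 'b) set \<Rightarrow> bool" where
  "matching N C \<mu> \<longleftrightarrow>
     (\<forall>(i, x)\<in>\<mu>. i \<in> N \<and> x \<in> acceptable C i) \<and>
     (\<forall>i x y. (i, x) \<in> \<mu> \<and> (i, y) \<in> \<mu> \<longrightarrow> x = y) \<and>
     (\<forall>i j x. (i, x) \<in> \<mu> \<and> (j, x) \<in> \<mu> \<longrightarrow> i = j)"

definition assigned :: "('a \<times> 'b) set \<Rightarrow> 'a \<Rightarrow> 'b option" where
  "assigned \<mu> i = (if i \<in> Domain \<mu> then Some (THE x. (i, x) \<in> \<mu>) else None)"

definition weakly_prefers ::
  "'b set \<Rightarrow> ('a \<Rightarrow> nat \<Rightarrow> 'b set) \<Rightarrow> 'a \<Rightarrow> 'b option \<Rightarrow> 'b option \<Rightarrow> bool" where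
  "weakly_prefers Obj C i a b \<longleftrightarrow> rank Obj C i a \<le> rank Obj C i b"

definition strictly_prefers ::
  "'b set \<Rightarrow> ('a \<Rightarrow> nat \<Rightarrow> 'b set) \<Rightarrow> 'a \<Rightarrow> 'b option \<Rightarrow> 'b option \<Rightarrow> bool" where
  "strictly_prefers Obj C i a b \<longleftrightarrow> rank Obj C i a < rank Obj C i b"

definition pareto_optimal ::
  "'a set \<Rightarrow> 'b set \<Rightarrow> ('a \<Rightarrow> nat \<Rightarrow> 'b set) \<Rightarrow> ('a \<times> 'b) set \<Rightarrow> bool" where
  "pareto_optimal N Obj C \<mu> \<longleftrightarrow>
     matching N C \<mu> \<and>
     \<not> (\<exists>\<mu>'. matching N C \<mu>' \<and>
            (\<forall>i\<in>N. weakly_prefers Obj C i (assigned \<mu>' i) (assigned \<mu> i)) \<and>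
            (\<exists>i\<in>N. strictly_prefers Obj C i (assigned \<mu>' i) (assigned \<mu> i)))"

text \<open>The bipartite graph has the disjoint sum of agents and objects as its vertices. Edge sets are
  kept as sets of (agent, object) pairs; \<open>edge (i, x)\<close> is the undirected edge that such a pair
  stands for. Paths are lists of distinct vertices.\<close>

fun edge :: "'a \<times> 'b \<Rightarrow> ('a + 'b) set" where
  "edge (i, x) = {Inl i, Inr x}"

definition path_edges :: "('a + 'b) list \<Rightarrow> ('a \<times> 'b) set" where
  "path_edges p = {e. \<exists>j. Suc j < length p \<and> edge e = {p ! j, p ! Suc j}}"

text \<open>The edges of an augmenting path at even positions, counted from 0, are outside the matching
  \<open>M\<close>, those at odd positions are in \<open>M\<close>; in particular the first edge is outside \<open>M\<close>.\<close>

definition augmenting_path ::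
  "'b set \<Rightarrow> ('a \<times> 'b) set \<Rightarrow> ('a \<times> 'b) set \<Rightarrow> 'a \<Rightarrow> ('a + 'b) list \<Rightarrow> bool" where
  "augmenting_path Obj E M i p \<longleftrightarrow>
     p \<noteq> [] \<and> distinct p \<and> hd p = Inl i \<and>
     (\<exists>x\<in>Obj. last p = Inr x \<and> x \<notin> Range M) \<and>
     (\<forall>j. Suc j < length p \<longrightarrow>
        {p ! j, p ! Suc j} \<in> edge ` E \<and>
        ({p ! j, p ! Suc j} \<in> edge ` M \<longleftrightarrow> odd j))"

text \<open>SDMT-1 is nondeterministic, hence a relation between states \<open>(E, M)\<close> consisting of the
  current edge set and the current matching. \<open>sdmt1_agent Obj C i l s t\<close> means that the inner loop
  for agent \<open>i\<close>, entered in state \<open>s\<close> with counter \<open>l\<close>, can end in state \<open>t\<close>. In rule \<open>next_class\<close>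
  the edges just added are dropped again, so the loop continues with \<open>E\<close>.\<close>

inductive sdmt1_agent ::
  "'b set \<Rightarrow> ('a \<Rightarrow> nat \<Rightarrow> 'b set) \<Rightarrow> 'a \<Rightarrow> nat \<Rightarrow>
   ('a \<times> 'b) set \<times> ('a \<times> 'b) set \<Rightarrow> ('a \<times> 'b) set \<times> ('a \<times> 'b) set \<Rightarrow> bool"
  for Obj :: "'b set" and C :: "'a \<Rightarrow> nat \<Rightarrow> 'b set" and i :: 'a where
  exhausted:
    "C i l = {} \<Longrightarrow> sdmt1_agent Obj C i l (E, M) (E, M)"
| augment:
    "C i l \<noteq> {} \<Longrightarrow> augmenting_path Obj (E \<union> {i} \<times> C i l) M i p \<Longrightarrow>
     sdmt1_agent Obj C i l (E, M) (E \<union> {i} \<times> C i l, sym_diff M (path_edges p))"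
| next_class:
    "C i l \<noteq> {} \<Longrightarrow> \<nexists>p. augmenting_path Obj (E \<union> {i} \<times> C i l) M i p \<Longrightarrow>
     sdmt1_agent Obj C i (Suc l) (E, M) t \<Longrightarrow>
     sdmt1_agent Obj C i l (E, M) t"

inductive sdmt1_run ::
  "'b set \<Rightarrow> ('a \<Rightarrow> nat \<Rightarrow> 'b set) \<Rightarrow> 'a list \<Rightarrow>
   ('a \<times> 'b) set \<times> ('a \<times> 'b) set \<Rightarrow> ('a \<times> 'b) set \<times> ('a \<times> 'b) set \<Rightarrow> bool"
  for Obj :: "'b set" and C :: "'a \<Rightarrow> nat \<Rightarrow> 'b set" where
  finished: "sdmt1_run Obj C [] s s"
| process: "sdmt1_agent Obj C i 1 s t \<Longrightarrow> sdmt1_run Obj C \<sigma> t u \<Longrightarrow> sdmt1_run Obj C (i # \<sigma>) s u"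

definition sdmt1_returns ::
  "'b set \<Rightarrow> ('a \<Rightarrow> nat \<Rightarrow> 'b set) \<Rightarrow> 'a list \<Rightarrow> ('a \<times> 'b) set \<Rightarrow> bool" where
  "sdmt1_returns Obj C \<sigma> \<mu> \<longleftrightarrow> (\<exists>E. sdmt1_run Obj C \<sigma> ({}, {}) (E, \<mu>))"

end

theory Submission
  imports Defs "HOL-Library.Transitive_Closure_Table"
begin

text \<open>An agent \<open>i\<close> that would strictly gain from some object, followed by agents who pass their
  own object on against one that is at least as good, forms a trading chain. If such a chain
  ended at a free object or at the object of \<open>i\<close>, performing the trades would improve \<open>\<mu>\<close>. Hence
  the relation ``a trading chain from \<open>i\<close> reaches the object of \<open>j\<close>'' is a strict partial order on
  the agents. Process the agents so that the \<open>j\<close> reached by \<open>i\<close> come before \<open>i\<close>. Then an augmenting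
  path of \<open>i\<close> through a class better than \<open>\<mu>(i)\<close> would be a trading chain to an object that is not
  held by an earlier agent, so none exists, and \<open>i\<close> may choose the path of length one to \<open>\<mu>(i)\<close>.\<close>

section \<open>Ranks, indifference classes and the inner loop\<close>

lemma assigned_eq_Some:
  assumes "matching N C \<mu>" "(i, x) \<in> \<mu>"
  shows "assigned \<mu> i = Some x"
proof -
  have "(THE y. (i, y) \<in> \<mu>) = x"
    using assms unfolding matching_def by (intro the_equality) blast+
  then show ?thesis using assms(2) by (auto simp: assigned_def)
qed

lemma assigned_eq_None: "i \<notin> Domain \<mu> \<Longrightarrow> assigned \<mu> i = None"
  by (simp add: assigned_def)

lemma rank_eq:
  assumes "house_allocation N Obj C" "i \<in> N" "k \<ge> 1" "x \<in> C i k"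
  shows "rank Obj C i (Some x) = k"
proof -
  have "(THE k. k \<ge> 1 \<and> x \<in> C i k) = k"
    using assms unfolding house_allocation_def by (intro the_equality) blast+
  then show ?thesis using assms(3,4) by (auto simp: rank_def acceptable_def)
qed

text \<open>Choosing one object from each of the first \<open>k\<close> classes is injective, since
  the classes are disjoint. Hence every nonempty class beats being unmatched, whose rank is
  \<open>card Obj + 1\<close>.\<close>

lemma class_index_le_card:
  assumes ha: "house_allocation N Obj C" and "i \<in> N" "k \<ge> 1" "C i k \<noteq> {}"
  shows "k \<le> card Obj"
proof -
  have sub: "C i l \<subseteq> Obj" and disj: "m \<ge> 1 \<Longrightarrow> l \<noteq> m \<Longrightarrow> C i l \<inter> C i m = {}"
    and initial: "m \<ge> l \<Longrightarrow> C i l = {} \<Longrightarrow> C i m = {}" if "l \<ge> 1" for l m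
    using ha \<open>i \<in> N\<close> that unfolding house_allocation_def by simp_all
  have ne: "C i l \<noteq> {}" if "l \<in> {1..k}" for l
    using initial[of l k] assms(4) that by auto
  define f where "f l = (SOME x. x \<in> C i l)" for l
  have f: "f l \<in> C i l" if "l \<in> {1..k}" for l
    using ne[OF that] by (auto simp: f_def some_in_eq)
  have "inj_on f {1..k}"
  proof (rule inj_onI)
    fix l m assume *: "l \<in> {1..k}" "m \<in> {1..k}" "f l = f m"
    then have "f l \<in> C i l \<inter> C i m" using f[of l] f[of m] by simp
    then show "l = m" using disj[of l m] * by auto
  qed
  moreover have "f ` {1..k} \<subseteq> Obj"
    using f sub by fastforce
  moreover have "finite Obj" using ha by (simp add: house_allocation_def)
  ultimately have "card {1..k} \<le> card Obj" by (intro card_inj_on_le)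
  then show ?thesis by simp
qed

text \<open>Rejected classes leave the state unchanged, so a loop entered at \<open>l\<close>
  extends backwards over them by \<open>next_class\<close>.\<close>

lemma sdmt1_agent_skip:
  assumes "m \<le> l" "sdmt1_agent Obj C i l (E, M) t"
    and "\<And>k. m \<le> k \<Longrightarrow> k < l \<Longrightarrow>
      C i k \<noteq> {} \<and> (\<nexists>p. augmenting_path Obj (E \<union> {i} \<times> C i k) M i p)"
  shows "sdmt1_agent Obj C i m (E, M) t"
  using assms
  by (induction m rule: inc_induct) (auto intro: sdmt1_agent.next_class)

section \<open>Trading chains\<close>

locale ha_matching =
  fixes N :: "'a set" and Obj :: "'b set" and C :: "'a \<Rightarrow> nat \<Rightarrow> 'b set"
    and \<mu> :: "('a \<times> 'b) set"
  assumes ha: "house_allocation N Obj C" and matching: "matching N C \<mu>"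
begin

definition strict_want :: "'a \<Rightarrow> 'b \<Rightarrow> bool" where
  "strict_want i x \<longleftrightarrow>
     i \<in> N \<and> x \<in> acceptable C i \<and> strictly_prefers Obj C i (Some x) (assigned \<mu> i)"

text \<open>An unacceptable object has the same rank as being unmatched, so ranks alone do not
  decide whether the object may be assigned.\<close>

definition weak_want :: "'a \<Rightarrow> 'b \<Rightarrow> bool" where
  "weak_want i x \<longleftrightarrow>
     i \<in> N \<and> x \<in> acceptable C i \<and> weakly_prefers Obj C i (Some x) (assigned \<mu> i)"

text \<open>The condition \<open>j \<noteq> i\<close> makes \<open>i\<close> open the chain without
  ever passing on an object. The definition allows repeated objects and the object of
  \<open>i\<close> itself as an endpoint.\<close>

inductive chain_reaches :: "'a \<Rightarrow> 'b \<Rightarrow> bool" for i where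
  start: "strict_want i x \<Longrightarrow> chain_reaches i x"
| pass: "chain_reaches i x \<Longrightarrow> (j, x) \<in> \<mu> \<Longrightarrow> j \<noteq> i \<Longrightarrow> weak_want j y \<Longrightarrow> chain_reaches i y"

lemma in_matchingD: "(i, x) \<in> \<mu> \<Longrightarrow> i \<in> N \<and> x \<in> acceptable C i"
  using matching unfolding matching_def by blast

lemma object_unique: "(i, x) \<in> \<mu> \<Longrightarrow> (i, y) \<in> \<mu> \<Longrightarrow> x = y"
  using matching unfolding matching_def by blast

lemma agent_unique: "(i, x) \<in> \<mu> \<Longrightarrow> (j, x) \<in> \<mu> \<Longrightarrow> i = j"
  using matching unfolding matching_def by blast

lemma strict_imp_weak_want: "strict_want i x \<Longrightarrow> weak_want i x"
  by (simp add: strict_want_def weak_want_def strictly_prefers_def weakly_prefers_def)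

lemma acceptable_subset: "i \<in> N \<Longrightarrow> acceptable C i \<subseteq> Obj"
  using ha unfolding house_allocation_def acceptable_def by auto

text \<open>All trades along \<open>q\<close> are carried out at once. The last object of
  \<open>q\<close> is free or given up by \<open>i\<close>, so no agent other than \<open>i\<close>
  hands over an object without a replacement at least as good, and \<open>i\<close> gains
  strictly.\<close>

lemma trade_not_pareto_optimal:
  assumes "q \<noteq> []" "distinct q" "strict_want i (hd q)"
    and link: "\<And>t. Suc t < length q \<Longrightarrow> \<exists>j. j \<noteq> i \<and> (j, q ! t) \<in> \<mu> \<and> weak_want j (q ! Suc t)"
    and last: "\<And>j. (j, last q) \<in> \<mu> \<Longrightarrow> j = i"
  shows "\<not> pareto_optimal N Obj C \<mu>"
proof
  assume po: "pareto_optimal N Obj C \<mu>"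
  define traded where "traded = {(j, q ! Suc t) | j t. Suc t < length q \<and> (j, q ! t) \<in> \<mu>}"
  \<comment> \<open>The old object of \<open>i\<close> is dropped whether or not it lies on
    \<open>q\<close>.\<close>
  define kept where "kept = {(j, y) \<in> \<mu>. j \<noteq> i \<and> y \<notin> set q}"
  define \<nu> where "\<nu> = insert (i, hd q) (traded \<union> kept)"
  have hd: "hd q = q ! 0" using assms(1) by (simp add: hd_conv_nth)
  have inj: "s = t" if "q ! s = q ! t" "s < length q" "t < length q" for s t
    using that assms(2) nth_eq_iff_index_eq by blast
  have pass_on: "j \<noteq> i \<and> weak_want j (q ! Suc t)" if "Suc t < length q" "(j, q ! t) \<in> \<mu>" for j t
    using link[OF that(1)] that(2) agent_unique by blast
  have "matching N C \<nu>" unfolding matching_def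
  proof (intro conjI allI impI ballI)
    show "case e of (k, x) \<Rightarrow> k \<in> N \<and> x \<in> acceptable C k" if "e \<in> \<nu>" for e
      using that assms(3) pass_on in_matchingD
      by (auto simp: \<nu>_def traded_def kept_def strict_want_def weak_want_def)
  next
    fix k x y assume "(k, x) \<in> \<nu> \<and> (k, y) \<in> \<nu>"
    moreover have "u = v" if "(k, u) \<in> traded" "(k, v) \<in> traded" for u v
    proof -
      from that obtain s t where "u = q ! Suc s" "v = q ! Suc t" "Suc s < length q"
        "Suc t < length q" "(k, q ! s) \<in> \<mu>" "(k, q ! t) \<in> \<mu>" by (auto simp: traded_def)
      with inj[of s t] object_unique[of k "q ! s" "q ! t"] show ?thesis by simp
    qed
    moreover have "k \<noteq> i" if "(k, u) \<in> traded" for u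
      using that pass_on by (auto simp: traded_def)
    moreover have "k \<noteq> i" if "(k, u) \<in> kept" for u
      using that by (auto simp: kept_def)
    moreover have False if "(k, u) \<in> traded" "(k, v) \<in> kept" for u v
    proof -
      from that obtain s where "Suc s < length q" "(k, q ! s) \<in> \<mu>" by (auto simp: traded_def)
      moreover from that have "(k, v) \<in> \<mu>" "v \<notin> set q" by (auto simp: kept_def)
      ultimately show False using object_unique[of k "q ! s" v] by auto
    qed
    moreover have "u = v" if "(k, u) \<in> kept" "(k, v) \<in> kept" for u v
      using that object_unique by (auto simp: kept_def)
    ultimately show "x = y" unfolding \<nu>_def by blast
  next
    \<comment> \<open>An object outside \<open>q\<close> comes only from \<open>kept\<close>,
      \<open>hd q\<close> goes only to \<open>i\<close>, and later entries come only from
      \<open>traded\<close>, where distinctness of \<open>q\<close> determines the position and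
      hence the former holder.\<close>
    fix j k x assume "(j, x) \<in> \<nu> \<and> (k, x) \<in> \<nu>"
    moreover have "x \<in> set q \<and> x \<noteq> hd q" if "(l, x) \<in> traded" for l
    proof -
      from that obtain s where "x = q ! Suc s" "Suc s < length q" by (auto simp: traded_def)
      then show ?thesis using inj[of "Suc s" 0] assms(1) by (auto simp: hd)
    qed
    moreover have "x \<notin> set q" if "(l, x) \<in> kept" for l
      using that by (auto simp: kept_def)
    moreover have "hd q \<in> set q" using assms(1) by simp
    moreover have "l = m" if "(l, x) \<in> traded" "(m, x) \<in> traded" for l m
    proof -
      from that obtain s t where *: "x = q ! Suc s" "x = q ! Suc t" "Suc s < length q"
        "Suc t < length q" "(l, q ! s) \<in> \<mu>" "(m, q ! t) \<in> \<mu>" unfolding traded_def by blast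
      then have "s = t" using inj[of "Suc s" "Suc t"] by simp
      with * show ?thesis using agent_unique by blast
    qed
    moreover have "l = m" if "(l, x) \<in> kept" "(m, x) \<in> kept" for l m
      using that agent_unique by (auto simp: kept_def)
    ultimately show "j = k" unfolding \<nu>_def by blast
  qed
  moreover have "strictly_prefers Obj C i (assigned \<nu> i) (assigned \<mu> i)"
    using assigned_eq_Some[OF \<open>matching N C \<nu>\<close>, of i "hd q"] assms(3)
    by (simp add: \<nu>_def strict_want_def)
  moreover have "weakly_prefers Obj C k (assigned \<nu> k) (assigned \<mu> k)" if "k \<in> N" for k
  proof (cases "k = i")
    case True
    then show ?thesis
      using calculation(2) by (simp add: strictly_prefers_def weakly_prefers_def)
  next
    case False
    consider (unmatched) "k \<notin> Domain \<mu>"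
      | (kept) y where "(k, y) \<in> \<mu>" "y \<notin> set q"
      | (traded) t where "(k, q ! t) \<in> \<mu>" "t < length q"
      by (metis Domain.simps in_set_conv_nth)
    then show ?thesis
    proof cases
      case unmatched
      then have "k \<notin> Domain \<nu>"
        using False by (auto simp: \<nu>_def traded_def kept_def)
      then show ?thesis
        using unmatched by (simp add: assigned_eq_None weakly_prefers_def)
    next
      case kept
      then have "(k, y) \<in> \<nu>" using False by (simp add: \<nu>_def kept_def)
      then show ?thesis
        using kept assigned_eq_Some[OF matching] assigned_eq_Some[OF \<open>matching N C \<nu>\<close>]
        by (simp add: weakly_prefers_def)
    next
      case traded
      \<comment> \<open>Only \<open>i\<close> can hold the last object of \<open>q\<close>, and
        \<open>k \<noteq> i\<close>.\<close>
      have "Suc t < length q"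
      proof (rule ccontr)
        assume "\<not> Suc t < length q"
        then have "t = length q - 1" using traded(2) by simp
        then have "q ! t = last q" using assms(1) by (simp add: last_conv_nth)
        then show False using traded(1) last False by auto
      qed
      then have "(k, q ! Suc t) \<in> \<nu>" "weak_want k (q ! Suc t)"
        using traded(1) pass_on by (auto simp: \<nu>_def traded_def)
      then show ?thesis
        using assigned_eq_Some[OF \<open>matching N C \<nu>\<close>] by (simp add: weak_want_def)
    qed
  qed
  moreover have "i \<in> N" using assms(3) by (simp add: strict_want_def)
  ultimately show False using po unfolding pareto_optimal_def by blast
qed

text \<open>Otherwise the chain ends at a free object or at the object of \<open>i\<close>, and
  trading along it would improve \<open>\<mu>\<close>.\<close>

lemma chain_reaches_held_by_other:
  assumes po: "pareto_optimal N Obj C \<mu>" and "chain_reaches i z"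
  shows "\<exists>j. j \<noteq> i \<and> (j, z) \<in> \<mu>"
proof (rule ccontr)
  assume "\<not> ?thesis"
  then have last: "j = i" if "(j, z) \<in> \<mu>" for j using that by blast
  define r where "r x y \<longleftrightarrow> (\<exists>j. j \<noteq> i \<and> (j, x) \<in> \<mu> \<and> weak_want j y)" for x y
  have "\<exists>x. strict_want i x \<and> r\<^sup>*\<^sup>* x z" using assms(2)
  proof induction
    case (start x)
    then show ?case by blast
  next
    case (pass x j y)
    then have "r x y" by (auto simp: r_def)
    with pass.IH show ?case by (meson rtranclp.rtrancl_into_rtrancl)
  qed
  then obtain x xs where x: "strict_want i x" and "rtrancl_path r x xs z"
    unfolding rtranclp_eq_rtrancl_path by blast
  \<comment> \<open>Cutting out loops yields a chain without repeated objects, so that each holder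
    trades only once.\<close>
  then obtain ys where ys: "rtrancl_path r x ys z" "distinct (x # ys)"
    by (meson rtrancl_path_distinct)
  have "\<not> pareto_optimal N Obj C \<mu>"
  proof (rule trade_not_pareto_optimal[of "x # ys" i])
    show "\<exists>j. j \<noteq> i \<and> (j, (x # ys) ! t) \<in> \<mu> \<and> weak_want j ((x # ys) ! Suc t)"
      if "Suc t < length (x # ys)" for t
      using rtrancl_path_nth[OF ys(1), of t] that by (simp add: r_def)
    have "List.last (x # ys) = z"
      using ys(1) by (cases "ys = []") (auto dest: rtrancl_path_last elim: rtrancl_path.cases)
    then show "j = i" if "(j, List.last (x # ys)) \<in> \<mu>" for j
      using that last by simp
  qed (use x ys(2) in simp_all)
  with po show False by contradiction
qed

text \<open>Chains concatenate: \<open>j\<close> passes on \<open>x\<close> against the first object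
  of its own chain, its strict want being used as a weak one. No holder met on the way is
  \<open>i\<close>, by \<open>chain_reaches_held_by_other\<close>.\<close>

lemma chain_reaches_trans:
  assumes po: "pareto_optimal N Obj C \<mu>" and "chain_reaches i x" "(j, x) \<in> \<mu>"
    and "chain_reaches j y"
  shows "chain_reaches i y"
  using assms(4)
proof induction
  have other: "k \<noteq> i" if "chain_reaches i w" "(k, w) \<in> \<mu>" for k w
    using chain_reaches_held_by_other[OF po that(1)] that(2) agent_unique by blast
  {
    case (start y)
    then show ?case
      using assms(2,3) other chain_reaches.pass strict_imp_weak_want by blast
  next
    case (pass y k z)
    then show ?case using other chain_reaches.pass by blast
  }
qed

section \<open>Intermediate states and augmenting paths\<close>

definition restricted :: "'a set \<Rightarrow> ('a \<times> 'b) set" where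
  "restricted P = {(j, x) \<in> \<mu>. j \<in> P}"

text \<open>The intended edge set once exactly the agents in \<open>P\<close> are processed: a
  matched agent leaves the whole class of its object in the graph, an unmatched one leaves
  nothing.\<close>

definition class_edges :: "'a set \<Rightarrow> ('a \<times> 'b) set" where
  "class_edges P = {(j, y). j \<in> P \<and> (\<exists>k x. k \<ge> 1 \<and> (j, x) \<in> \<mu> \<and> x \<in> C j k \<and> y \<in> C j k)}"

lemma class_edges_weak_want: "(j, y) \<in> class_edges P \<Longrightarrow> weak_want j y"
proof -
  assume "(j, y) \<in> class_edges P"
  then obtain k x where *: "k \<ge> 1" "(j, x) \<in> \<mu>" "x \<in> C j k" "y \<in> C j k"
    by (auto simp: class_edges_def)
  then have "j \<in> N" using in_matchingD by blast
  then show ?thesis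
    using * rank_eq[OF ha] assigned_eq_Some[OF matching]
    by (auto simp: weak_want_def weakly_prefers_def acceptable_def)
qed

text \<open>Read from \<open>i\<close>, an augmenting path is a trading chain: its edges outside the
  matching express wants, and its matching edges lead from an object to its holder.\<close>

lemma augmenting_path_chain:
  assumes path: "augmenting_path Obj (class_edges P \<union> {i} \<times> C i l) (restricted P) i p"
    and "i \<notin> P" and strict: "\<And>y. y \<in> C i l \<Longrightarrow> strict_want i y"
  obtains x where "chain_reaches i x" "x \<notin> Range (restricted P)"
proof -
  let ?E = "class_edges P \<union> {i} \<times> C i l"
  have "\<exists>x. last p = Inr x \<and> x \<notin> Range (restricted P)"
    using path by (auto simp: augmenting_path_def)
  then obtain x where "last p = Inr x" "x \<notin> Range (restricted P)" by blast
  moreover have "p \<noteq> []" "hd p = Inl i" using path by (simp_all add: augmenting_path_def)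
  ultimately have p: "p \<noteq> []" "hd p = Inl i" "last p = Inr x" "x \<notin> Range (restricted P)"
    by simp_all
  have step: "{p ! j, p ! Suc j} \<in> edge ` ?E" "odd j \<Longrightarrow> {p ! j, p ! Suc j} \<in> edge ` restricted P"
    if "Suc j < length p" for j
    using path that unfolding augmenting_path_def by blast+
  have edgeE: "\<exists>a y. (a, y) \<in> F \<and> e = {Inl a, Inr y}" if "e \<in> edge ` F"
    for e and F :: "('a \<times> 'b) set"
    using that by (metis edge.simps imageE surj_pair)
  \<comment> \<open>Agents sit at even positions, objects at odd ones. An agent other than
    \<open>i\<close> holds an object already reached, as rule \<open>pass\<close> demands.\<close>
  have inv: "if even k then p ! k = Inl i \<or>
               (\<exists>a \<in> P. \<exists>y. p ! k = Inl a \<and> chain_reaches i y \<and> (a, y) \<in> \<mu>)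
             else \<exists>y. p ! k = Inr y \<and> chain_reaches i y" if "k < length p" for k
    using that
  proof (induction k)
    case 0
    then show ?case using p by (simp add: hd_conv_nth)
  next
    case (Suc k)
    show ?case
    proof (cases "even k")
      case True
      from edgeE[OF step(1)[OF Suc.prems]] obtain a y where
        ay: "(a, y) \<in> ?E" "{p ! k, p ! Suc k} = {Inl a, Inr y}"
        by auto
      from Suc True consider "p ! k = Inl i"
        | b z where "p ! k = Inl b" "b \<in> P" "chain_reaches i z" "(b, z) \<in> \<mu>"
        by auto
      then show ?thesis
      proof cases
        case 1
        then have "a = i" "p ! Suc k = Inr y" using ay(2) by (auto simp: doubleton_eq_iff)
        \<comment> \<open>Since \<open>i \<notin> P\<close>, all edges at \<open>i\<close> come from
          the class under test.\<close>
        moreover have "y \<in> C i l"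
          using ay(1) \<open>a = i\<close> \<open>i \<notin> P\<close> by (auto simp: class_edges_def)
        ultimately show ?thesis using True strict chain_reaches.start by simp
      next
        case 2
        then have "a = b" "p ! Suc k = Inr y" using ay(2) by (auto simp: doubleton_eq_iff)
        moreover have "a \<noteq> i" using \<open>a = b\<close> 2(2) \<open>i \<notin> P\<close> by blast
        moreover have "weak_want a y"
          using ay(1) \<open>a \<noteq> i\<close> class_edges_weak_want by blast
        ultimately show ?thesis using True 2 chain_reaches.pass by auto
      qed
    next
      case False
      with Suc obtain z where z: "p ! k = Inr z" "chain_reaches i z" by auto
      from edgeE[OF step(2)[OF Suc.prems]] False obtain a y where
        ay: "(a, y) \<in> restricted P" "{p ! k, p ! Suc k} = {Inl a, Inr y}"
        by auto
      then have "p ! Suc k = Inl a" "y = z" using z(1) by (auto simp: doubleton_eq_iff)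
      then show ?thesis using False z ay(1) by (auto simp: restricted_def)
    qed
  qed
  \<comment> \<open>The last vertex is an object, so its position is odd.\<close>
  have "chain_reaches i x"
    using inv[of "length p - 1"] p by (auto simp: last_conv_nth split: if_splits)
  with p(4) show thesis using that by blast
qed

section \<open>Processing one agent\<close>

text \<open>By \<open>before\<close>, every object reached by \<open>i\<close> is already taken in
  \<open>restricted P\<close>, so all classes better than the assignment of \<open>i\<close> fail. A
  matched \<open>i\<close> then succeeds at the class of its object; for an unmatched
  \<open>i\<close> all classes are better, and the loop runs out with the state unchanged.\<close>

lemma sdmt1_agent_step:
  assumes po: "pareto_optimal N Obj C \<mu>" and "i \<in> N" "i \<notin> P"
    and before: "\<And>j x. chain_reaches i x \<Longrightarrow> (j, x) \<in> \<mu> \<Longrightarrow> j \<in> P"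
  shows "sdmt1_agent Obj C i 1 (class_edges P, restricted P)
    (class_edges (insert i P), restricted (insert i P))"
proof -
  have no_path: "\<nexists>p. augmenting_path Obj (class_edges P \<union> {i} \<times> C i l) (restricted P) i p"
    if *: "\<And>y. y \<in> C i l \<Longrightarrow> strict_want i y" for l
  proof
    assume "\<exists>p. augmenting_path Obj (class_edges P \<union> {i} \<times> C i l) (restricted P) i p"
    then obtain x where x: "chain_reaches i x" "x \<notin> Range (restricted P)"
      using augmenting_path_chain[OF _ \<open>i \<notin> P\<close> *] by blast
    moreover obtain j where "(j, x) \<in> \<mu>"
      using chain_reaches_held_by_other[OF po x(1)] by blast
    ultimately show False using before by (auto simp: restricted_def)
  qed
  have strict: "strict_want i y"
    if "y \<in> C i l" "1 \<le> l" "l < rank Obj C i (assigned \<mu> i)" for y l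
    using that rank_eq[OF ha \<open>i \<in> N\<close>] \<open>i \<in> N\<close>
    by (auto simp: strict_want_def strictly_prefers_def acceptable_def)
  show ?thesis
  proof (cases "i \<in> Domain \<mu>")
    case True
    then obtain x where x: "(i, x) \<in> \<mu>" by blast
    then obtain k where k: "k \<ge> 1" "x \<in> C i k"
      using in_matchingD by (auto simp: acceptable_def)
    have rank: "rank Obj C i (assigned \<mu> i) = k"
      using assigned_eq_Some[OF matching x] rank_eq[OF ha \<open>i \<in> N\<close> k] by simp
    \<comment> \<open>The object of \<open>i\<close> lies in class \<open>k\<close> only, so
      inserting \<open>i\<close> adds exactly the edges that the loop adds at
      \<open>k\<close>.\<close>
    have E: "class_edges (insert i P) = class_edges P \<union> {i} \<times> C i k"
    proof -
      have "m = k" if "m \<ge> 1" "(i, z) \<in> \<mu>" "z \<in> C i m" for m z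
        using rank_eq[OF ha \<open>i \<in> N\<close> that(1,3)] rank_eq[OF ha \<open>i \<in> N\<close> k]
          object_unique[OF x that(2)] by simp
      then have "(\<exists>m z. m \<ge> 1 \<and> (i, z) \<in> \<mu> \<and> z \<in> C i m \<and> y \<in> C i m) \<longleftrightarrow> y \<in> C i k" for y
        using x k by blast
      then show ?thesis unfolding class_edges_def by blast
    qed
    \<comment> \<open>The free choice of path is made here: the single edge to \<open>x\<close>,
      which is unmatched because its only holder under \<open>\<mu>\<close> is
      \<open>i\<close>.\<close>
    let ?p = "[Inl i, Inr x] :: ('a + 'b) list"
    have single: "Suc j < length ?p \<longleftrightarrow> j = 0" for j by auto
    have edge_eq: "edge e = {Inl i, Inr x} \<longleftrightarrow> e = (i, x)" for e :: "'a \<times> 'b"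
      by (cases e) (auto simp: doubleton_eq_iff)
    have edges: "path_edges ?p = {(i, x)}"
      unfolding path_edges_def single by (simp add: edge_eq)
    have M: "restricted (insert i P) = sym_diff (restricted P) {(i, x)}"
      using x \<open>i \<notin> P\<close> object_unique by (auto simp: restricted_def)
    have "x \<notin> Range (restricted P)"
      using x \<open>i \<notin> P\<close> agent_unique by (auto simp: restricted_def)
    moreover have "{Inl i, Inr x} \<notin> edge ` restricted P"
    proof
      assume "{Inl i, Inr x} \<in> edge ` restricted P"
      then have "(i, x) \<in> restricted P" using edge_eq by (metis imageE)
      then show False using \<open>i \<notin> P\<close> by (simp add: restricted_def)
    qed
    moreover have "{Inl i, Inr x} \<in> edge ` (class_edges P \<union> {i} \<times> C i k)"
      using k(2) by (intro image_eqI[of _ _ "(i, x)"]) simp_all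
    moreover have "x \<in> Obj" using x in_matchingD acceptable_subset by blast
    ultimately have "augmenting_path Obj (class_edges P \<union> {i} \<times> C i k) (restricted P) i ?p"
      unfolding augmenting_path_def single by simp
    moreover have "C i k \<noteq> {}" using k(2) by blast
    ultimately have aug: "sdmt1_agent Obj C i k (class_edges P, restricted P)
      (class_edges (insert i P), restricted (insert i P))"
      unfolding E M edges[symmetric] by (intro sdmt1_agent.augment)
    show ?thesis
    proof (rule sdmt1_agent_skip[OF k(1) aug])
      fix l assume l: "1 \<le> l" "l < k"
      moreover have "C i l = {} \<Longrightarrow> C i k = {}"
        using ha \<open>i \<in> N\<close> l unfolding house_allocation_def by simp
      ultimately have "C i l \<noteq> {}" using \<open>C i k \<noteq> {}\<close> by blast
      then show "C i l \<noteq> {} \<and>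
          (\<nexists>p. augmenting_path Obj (class_edges P \<union> {i} \<times> C i l) (restricted P) i p)"
        using no_path strict l rank by blast
    qed
  next
    case False
    then have rank: "rank Obj C i (assigned \<mu> i) = card Obj + 1"
      by (simp add: assigned_eq_None rank_def)
    have same: "class_edges (insert i P) = class_edges P" "restricted (insert i P) = restricted P"
      using False by (auto simp: class_edges_def restricted_def)
    \<comment> \<open>The loop stops at the first empty class; one exists because class
      \<open>card Obj + 1\<close> is empty.\<close>
    define m where "m = (LEAST m. m \<ge> 1 \<and> C i m = {})"
    have "card Obj + 1 \<ge> 1 \<and> C i (card Obj + 1) = {}"
      using class_index_le_card[OF ha \<open>i \<in> N\<close>, of "card Obj + 1"] by auto
    then have m: "m \<ge> 1" "C i m = {}"
      unfolding m_def by (rule LeastI2; simp)+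
    show ?thesis unfolding same
    proof (rule sdmt1_agent_skip[OF m(1) sdmt1_agent.exhausted[of C, OF m(2)]])
      fix l assume l: "1 \<le> l" "l < m"
      then have ne: "C i l \<noteq> {}" using not_less_Least unfolding m_def by blast
      then have "l < rank Obj C i (assigned \<mu> i)"
        using class_index_le_card[OF ha \<open>i \<in> N\<close> l(1)] rank by simp
      then show "C i l \<noteq> {} \<and>
          (\<nexists>p. augmenting_path Obj (class_edges P \<union> {i} \<times> C i l) (restricted P) i p)"
        using no_path strict l(1) ne by blast
    qed
  qed
qed

section \<open>Order of the agents\<close>

text \<open>Here \<open>U\<close> holds the agents still to be processed. The induction removes a
  minimal one, which becomes the head of \<open>\<sigma>\<close>; \<open>U = N\<close> gives the
  full run.\<close>

lemma sdmt1_run_remaining: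
  assumes po: "pareto_optimal N Obj C \<mu>" and "U \<subseteq> N"
  shows "\<exists>\<sigma>. distinct \<sigma> \<and> set \<sigma> = U \<and>
    sdmt1_run Obj C \<sigma> (class_edges (N - U), restricted (N - U)) (class_edges N, restricted N)"
proof -
  \<comment> \<open>\<open>R j i\<close> says that \<open>j\<close> has to be processed before
    \<open>i\<close>.\<close>
  define R where "R j i \<longleftrightarrow> (\<exists>x. chain_reaches i x \<and> (j, x) \<in> \<mu>)" for j i
  have irrefl: "\<not> R i i" for i
    unfolding R_def using chain_reaches_held_by_other[OF po] agent_unique by metis
  have trans: "R j i" if "R j k" "R k i" for i j k
    using that chain_reaches_trans[OF po] unfolding R_def by blast
  have asymp: "asymp_on A R" and transp: "transp_on A R" for A
    using irrefl trans by (auto intro!: asymp_onI transp_onI)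
  have "finite U" using assms(2) ha by (auto simp: house_allocation_def intro: finite_subset)
  then show ?thesis using assms(2)
  proof (induction rule: finite_psubset_induct)
    case (psubset U)
    show ?case
    proof (cases "U = {}")
      case True
      then show ?thesis by (auto intro: sdmt1_run.finished)
    next
      case False
      obtain i where i: "i \<in> U" "\<forall>j\<in>U. j \<noteq> i \<longrightarrow> \<not> R j i"
        using Finite_Set.bex_min_element[OF psubset(1) asymp transp False] by blast
      have "U - {i} \<subset> U" "U - {i} \<subseteq> N" using i(1) psubset.prems by auto
      from psubset.IH[OF this] obtain \<sigma> where \<sigma>: "distinct \<sigma>" "set \<sigma> = U - {i}"
        "sdmt1_run Obj C \<sigma> (class_edges (N - (U - {i})), restricted (N - (U - {i})))
          (class_edges N, restricted N)" by blast
      have ins: "N - (U - {i}) = insert i (N - U)" using i(1) psubset.prems by blast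
      have "sdmt1_agent Obj C i 1 (class_edges (N - U), restricted (N - U))
        (class_edges (insert i (N - U)), restricted (insert i (N - U)))"
      proof (rule sdmt1_agent_step[OF po])
        fix j x assume "chain_reaches i x" "(j, x) \<in> \<mu>"
        then have "R j i" by (auto simp: R_def)
        \<comment> \<open>Minimality excludes the other agents of \<open>U\<close>, irreflexivity
          excludes \<open>i\<close> itself.\<close>
        then have "j \<notin> U" using i(2) irrefl by metis
        then show "j \<in> N - U" using in_matchingD[OF \<open>(j, x) \<in> \<mu>\<close>] by blast
      qed (use i psubset.prems in auto)
      then have "sdmt1_run Obj C (i # \<sigma>) (class_edges (N - U), restricted (N - U))
          (class_edges N, restricted N)"
        using \<sigma>(3) unfolding ins by (rule sdmt1_run.process)
      moreover have "distinct (i # \<sigma>)" "set (i # \<sigma>) = U" using \<sigma> i(1) by auto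
      ultimately show ?thesis by blast
    qed
  qed
qed

end

theorem theorem3p7:
  fixes N :: "'a set" and Obj :: "'b set" and C :: "'a \<Rightarrow> nat \<Rightarrow> 'b set"
    and \<mu> :: "('a \<times> 'b) set"
  assumes "house_allocation N Obj C"
    and "pareto_optimal N Obj C \<mu>"
  shows "\<exists>\<sigma>. distinct \<sigma> \<and> set \<sigma> = N \<and> sdmt1_returns Obj C \<sigma> \<mu>"
proof -
  interpret ha_matching N Obj C \<mu>
    using assms by unfold_locales (simp_all add: pareto_optimal_def)
  \<comment> \<open>With \<open>U = N\<close> the run starts at \<open>N - N = {}\<close>, the empty
    initial state, and ends with the matching \<open>\<mu>\<close>.\<close>
  have "restricted N = \<mu>" "restricted {} = {}" "class_edges {} = {}"
    using in_matchingD by (auto simp: restricted_def class_edges_def)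
  then show ?thesis
    using sdmt1_run_remaining[OF assms(2) subset_refl] unfolding sdmt1_returns_def by auto
qed

end
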